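(* Let $C=\sum_{k=0}^{\infty}\frac{(-1)^k}{(2k+1)^2}$ be Catalan's constant. Then $$C=\cfrac{1}{1+\cfrac{1^4}{8+\cfrac{3^4}{16+\cfrac{5^4}{24+\cdots}}}},$$ that is, the continued fraction with first partial numerator $1$ and first partial denominator $1$, followed by partial numerators $(2k-1)^4$ and partial denominators $8k$ for $k=1,2,3,\dots$, converges to $C$.
   Context: The value of an infinite continued fraction is the limit of its finite truncations $\cfrac{a_1}{b_1+\cfrac{a_2}{b_2+\cdots+\cfrac{a_N}{b_N}}}$ as $N\to\infty$, where $a_n$ are the partial numerators and $b_n$ the partial denominators. *)

theory Defs
  imports "HOL-Analysis.Analysis"
begin

definition catalan_constant :: real where
  "catalan_constant = (\<Sum>k. (- 1) ^ k / (2 * real k + 1) ^ 2)"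

lemma summable_catalan: "summable (\<lambda>k. (- 1) ^ k / (2 * real k + 1) ^ 2)"
proof (rule summable_comparison_test')
  show "summable (\<lambda>k. 1 / (real (Suc k)) ^ 2)"
    using inverse_squares_sums by (simp add: sums_iff add.commute)
  show "norm ((- 1) ^ k / (2 * real k + 1) ^ 2) \<le> 1 / (real (Suc k)) ^ 2" for k
    by (auto simp: power_abs intro!: frac_le power_mono)
qed

(* cf_segment a b k m = a k / (b k + a (k+1) / (b (k+1) + ... + a (k+m-1) / b (k+m-1))).
   Division by zero is total here, so the value is the intended one only as long
   as no denominator vanishes, e.g. when all a n and b n are positive. *)
primrec cf_segment :: "(nat \<Rightarrow> real) \<Rightarrow> (nat \<Rightarrow> real) \<Rightarrow> nat \<Rightarrow> nat \<Rightarrow> real" where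
  "cf_segment a b k 0 = 0"
| "cf_segment a b k (Suc m) = a k / (b k + cf_segment a b (Suc k) m)"

(* Indices start at 1; a 0 and b 0 are never used. *)
definition cf_truncation :: "(nat \<Rightarrow> real) \<Rightarrow> (nat \<Rightarrow> real) \<Rightarrow> nat \<Rightarrow> real" where
  "cf_truncation a b N = cf_segment a b 1 N"

definition cf_converges_to :: "(nat \<Rightarrow> real) \<Rightarrow> (nat \<Rightarrow> real) \<Rightarrow> real \<Rightarrow> bool" where
  "cf_converges_to a b L \<longleftrightarrow> cf_truncation a b \<longlonglongrightarrow> L"

end

theory Submission
  imports Defs
begin

text \<open>
  By Euler's correspondence between series and continued fractions, the truncations are exactly
  the partial sums of Catalan's series: with \<open>c k = (2 * k + 1)\<^sup>2\<close> one has \<open>8 * k = c k - c (k - 1)\<close> and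
  \<open>(2 * k - 1) ^ 4 = (c (k - 1))\<^sup>2\<close>, and the identity \<open>1 / (c + c\<^sup>2 / (D - c)) = 1 / c - 1 / D\<close>
  peels off one term of the series at each level.
\<close>

lemma cf_segment_nonneg:
  assumes "\<And>i. i \<ge> k \<Longrightarrow> a i \<ge> 0" and "\<And>i. i \<ge> k \<Longrightarrow> b i \<ge> 0"
  shows "cf_segment a b k m \<ge> 0"
  using assms by (induction m arbitrary: k) auto

text \<open>Peeling off the outermost level shifts \<open>k\<close> to \<open>Suc k\<close>, so the
  induction on \<open>m\<close> needs \<open>k\<close> arbitrary. The offset \<open>k + 2\<close>
  leaves index 1 for the outer \<open>1 / (c 0 + ...)\<close>.\<close>

lemma euler_cf_segment:
  fixes a b c :: "nat \<Rightarrow> real"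
  assumes pos: "\<And>k. c k > 0" and mono: "\<And>k. c k < c (Suc k)"
    and a: "\<And>k. a (k + 2) = (c k)\<^sup>2" and b: "\<And>k. b (k + 2) = c (Suc k) - c k"
  shows "1 / (c k + cf_segment a b (k + 2) m) = (\<Sum>j<Suc m. (- 1) ^ j / c (k + j))"
proof (induction m arbitrary: k)
  case 0
  then show ?case by simp
next
  case (Suc m)
  define D where "D = c (Suc k) + cf_segment a b (Suc k + 2) m"
  \<comment> \<open>A nonnegative tail forces \<open>D > c k > 0\<close>, so the divisions by
    \<open>D - c k\<close> and \<open>D\<close> below are genuine.\<close>
  have "cf_segment a b (Suc k + 2) m \<ge> 0"
  proof (rule cf_segment_nonneg)
    fix i assume "i \<ge> Suc k + 2"
    then obtain l where "i = l + 2" by (metis add.commute add_leD2 le_Suc_ex)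
    then show "a i \<ge> 0" "b i \<ge> 0" using a[of l] b[of l] mono[of l] by simp_all
  qed
  with mono[of k] have D: "D > c k" by (simp add: D_def)
  have "cf_segment a b (k + 2) (Suc m) = (c k)\<^sup>2 / (D - c k)"
    using a[of k] b[of k] by (simp add: D_def algebra_simps)
  then have "1 / (c k + cf_segment a b (k + 2) (Suc m)) = 1 / (c k + (c k)\<^sup>2 / (D - c k))"
    by simp
  also have "c k + (c k)\<^sup>2 / (D - c k) = c k * D / (D - c k)"
    using D by (simp add: field_simps power2_eq_square)
  also have "1 / (c k * D / (D - c k)) = 1 / c k - 1 / D"
    using D pos[of k] by (simp add: field_simps)
  also have "1 / D = (\<Sum>j<Suc m. (- 1) ^ j / c (Suc k + j))"
    unfolding D_def by (rule Suc.IH)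
  \<comment> \<open>The term \<open>1 / c k\<close> is the summand \<open>j = 0\<close>; shifting
    the index absorbs the minus sign.\<close>
  also have "1 / c k - \<dots> = (\<Sum>j<Suc (Suc m). (- 1) ^ j / c (k + j))"
    by (subst (2) sum.lessThan_Suc_shift) (simp add: sum_negf del: sum.lessThan_Suc)
  finally show ?case .
qed

theorem mainTheorem7:
  fixes a b :: "nat \<Rightarrow> real"
  assumes "a 1 = 1" and "b 1 = 1"
    and "\<And>k. k \<ge> 1 \<Longrightarrow> a (k + 1) = (2 * real k - 1) ^ 4"
    and "\<And>k. k \<ge> 1 \<Longrightarrow> b (k + 1) = 8 * real k"
  shows "cf_converges_to a b catalan_constant"
proof -
  define c :: "nat \<Rightarrow> real" where "c k = (2 * real k + 1) ^ 2" for k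
  have a: "a (k + 2) = (c k)\<^sup>2" for k
    using assms(3)[of "k + 1"] by (simp add: c_def add.commute flip: power_mult)
  have b: "b (k + 2) = c (Suc k) - c k" for k
    using assms(4)[of "k + 1"] by (simp add: c_def power2_eq_square algebra_simps)
  have "c k > 0" "c k < c (Suc k)" for k
    by (auto simp: c_def intro!: power_strict_mono)
  \<comment> \<open>Since \<open>a 1 = 1\<close> and \<open>b 1 = 1 = c 0\<close>, the case
    \<open>k = 0\<close> is a whole truncation with \<open>Suc m\<close> levels.\<close>
  from euler_cf_segment[OF this a b, of 0]
  have "cf_truncation a b (Suc m) = (\<Sum>j<Suc m. (- 1) ^ j / (2 * real j + 1) ^ 2)" for m
    using assms(1,2)
    by (simp add: cf_truncation_def c_def numeral_2_eq_2 del: sum.lessThan_Suc)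
  then have "cf_truncation a b m = (\<Sum>j<m. (- 1) ^ j / (2 * real j + 1) ^ 2)" for m
    by (cases m) (simp_all add: cf_truncation_def del: sum.lessThan_Suc cf_segment.simps(2))
  then have "cf_truncation a b = (\<lambda>m. \<Sum>j<m. (- 1) ^ j / (2 * real j + 1) ^ 2)"
    by (rule ext)
  with summable_LIMSEQ[OF summable_catalan] show ?thesis
    by (simp only: cf_converges_to_def catalan_constant_def)
qed

end
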